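(* Let $a>0$ and let $\kappa_n(a)=\int_{-\infty}^\infty\lambda^n\,d\rho_a(\lambda)$, $n\in\mathbb{Z}_+$, be the moments of the measure $d\rho_a(\lambda)=d(E_a(\lambda)e_0,e_0)$. Then $$\sum_{n=0}^\infty\kappa_n(a)\,\zeta^n=\frac{2}{a^2\sqrt{1-\zeta^2}+2-a^2},$$ where the series on the left-hand side converges for $|\zeta|<1$ if $a\le\sqrt2$ and for $|\zeta|<2a^{-2}\sqrt{a^2-1}$ if $a>\sqrt2$.
   Context: $\mathbb{Z}_+=\{0,1,2,\dots\}$ and $(e_n)_{n\ge0}$ is the canonical orthonormal basis of $\ell^2(\mathbb{Z}_+)$. For $a>0$, $H_a$ is the bounded self-adjoint operator on $\ell^2(\mathbb{Z}_+)$ given by $$H_ae_0=\tfrac a2e_1,\qquad H_ae_1=\tfrac12(ae_0+e_2),\qquad H_ae_n=\tfrac12(e_{n-1}+e_{n+1})\ \ (n\ge2),$$ and $E_a(\cdot)$ is its spectral measure. The function $\sqrt{1-\zeta^2}$ is the analytic branch in the unit disc equal to $1$ at $\zeta=0$. *)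

theory Defs
  imports "HOL-Analysis.Analysis"
begin

section \<open>The complex Hilbert space of square-summable sequences\<close>

typedef ell2 = "{x :: nat \<Rightarrow> complex. summable (\<lambda>n. (cmod (x n))\<^sup>2)}"
  morphisms coord Ell2
  by (rule exI[of _ "\<lambda>_. 0"]) simp

setup_lifting type_definition_ell2

lemma ell2_eqI: "(\<And>n. coord x n = coord y n) \<Longrightarrow> x = y"
  by (metis coord_inject ext)

lemma summable_coord: "summable (\<lambda>n. (cmod (coord x n))\<^sup>2)"
  using coord[of x] by simp

lemma cmod_add_squared_le: "(cmod (u + v))\<^sup>2 \<le> 2 * (cmod u)\<^sup>2 + 2 * (cmod v)\<^sup>2"
proof -
  have "(cmod (u + v))\<^sup>2 \<le> (cmod u + cmod v)\<^sup>2"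
    by (simp add: norm_triangle_ineq power_mono)
  also have "\<dots> \<le> 2 * (cmod u)\<^sup>2 + 2 * (cmod v)\<^sup>2"
    using sum_squares_bound[of "cmod u" "cmod v"] by (simp add: power2_sum)
  finally show ?thesis .
qed

lemma summable_cmod_squared_add:
  assumes "summable (\<lambda>n. (cmod (x n))\<^sup>2)" "summable (\<lambda>n. (cmod (y n))\<^sup>2)"
  shows "summable (\<lambda>n. (cmod (x n + y n))\<^sup>2)"
proof (rule summable_comparison_test')
  show "summable (\<lambda>n. 2 * (cmod (x n))\<^sup>2 + 2 * (cmod (y n))\<^sup>2)"
    using assms by (intro summable_add summable_mult)
qed (use cmod_add_squared_le in auto)

lemma summable_cmod_squared_mult:
  "summable (\<lambda>n. (cmod (x n))\<^sup>2) \<Longrightarrow> summable (\<lambda>n. (cmod (c * x n))\<^sup>2)"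
  by (simp add: norm_mult power_mult_distrib summable_mult)

lemma summable_cinner: "summable (\<lambda>n. coord x n * cnj (coord y n))"
proof (rule summable_comparison_test')
  show "summable (\<lambda>n. (cmod (coord x n))\<^sup>2 + (cmod (coord y n))\<^sup>2)"
    by (intro summable_add summable_coord)
  fix n
  show "cmod (coord x n * cnj (coord y n)) \<le> (cmod (coord x n))\<^sup>2 + (cmod (coord y n))\<^sup>2"
  proof -
    have "2 * cmod (coord x n) * cmod (coord y n) \<le> (cmod (coord x n))\<^sup>2 + (cmod (coord y n))\<^sup>2"
      by (rule sum_squares_bound)
    moreover have "0 \<le> cmod (coord x n) * cmod (coord y n)" by simp
    ultimately show ?thesis unfolding norm_mult complex_mod_cnj by linarith
  qed
qed

text \<open>The scalar product is linear in the first argument.\<close>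

definition cinner :: "ell2 \<Rightarrow> ell2 \<Rightarrow> complex"
  where "cinner x y = (\<Sum>n. coord x n * cnj (coord y n))"

lemma cinner_commute: "cinner x y = cnj (cinner y x)"
proof -
  have "(\<lambda>n. cnj (coord y n * cnj (coord x n))) sums cnj (cinner y x)"
    unfolding cinner_def sums_cnj by (rule summable_sums[OF summable_cinner])
  then show ?thesis by (simp add: cinner_def sums_iff mult.commute)
qed

lift_definition cscale :: "complex \<Rightarrow> ell2 \<Rightarrow> ell2"  (infixr "*\<^sub>c" 75)
  is "\<lambda>c x n. c * x n"
  by (rule summable_cmod_squared_mult)

text \<open>
  The topology is that of the norm; the real inner product is the real part of the scalar
  product.
\<close>

instantiation ell2 :: real_inner
begin

lift_definition zero_ell2 :: ell2 is "\<lambda>_. 0" by simp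
lift_definition plus_ell2 :: "ell2 \<Rightarrow> ell2 \<Rightarrow> ell2" is "\<lambda>x y n. x n + y n"
  by (rule summable_cmod_squared_add)
lift_definition uminus_ell2 :: "ell2 \<Rightarrow> ell2" is "\<lambda>x n. - x n" by simp
lift_definition minus_ell2 :: "ell2 \<Rightarrow> ell2 \<Rightarrow> ell2" is "\<lambda>x y n. x n - y n"
  subgoal for x y using summable_cmod_squared_add[of x "\<lambda>n. - y n"] by simp
  done
lift_definition scaleR_ell2 :: "real \<Rightarrow> ell2 \<Rightarrow> ell2" is "\<lambda>r x n. complex_of_real r * x n"
  by (rule summable_cmod_squared_mult)

definition inner_ell2 :: "ell2 \<Rightarrow> ell2 \<Rightarrow> real" where "inner x y = Re (cinner x y)"
definition norm_ell2 :: "ell2 \<Rightarrow> real" where "norm x = sqrt (\<Sum>n. (cmod (coord x n))\<^sup>2)"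
definition sgn_ell2 :: "ell2 \<Rightarrow> ell2" where "sgn x = inverse (norm x) *\<^sub>R x" for x :: ell2
definition dist_ell2 :: "ell2 \<Rightarrow> ell2 \<Rightarrow> real" where "dist x y = norm (x - y)" for x y :: ell2
definition uniformity_ell2 :: "(ell2 \<times> ell2) filter"
  where "uniformity_ell2 = (INF e\<in>{0<..}. principal {(x :: ell2, y). dist x y < e})"
definition open_ell2 :: "ell2 set \<Rightarrow> bool"
  where "open_ell2 (U :: ell2 set) \<longleftrightarrow> (\<forall>x\<in>U. eventually (\<lambda>(x', y). x' = x \<longrightarrow> y \<in> U) uniformity)"

lemma inner_self_ell2: "inner x x = (\<Sum>n. (cmod (coord x n))\<^sup>2)" for x :: ell2
  unfolding inner_ell2_def cinner_def
  by (subst Re_suminf[OF summable_cinner]) (simp add: complex_norm_square[symmetric])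

instance
proof
  fix x y z :: ell2 and r s :: real
  show "x + y + z = x + (y + z)" by transfer (simp add: add.assoc)
  show "x + y = y + x" by transfer (simp add: add.commute)
  show "0 + x = x" by transfer simp
  show "- x + x = 0" by transfer simp
  show "x - y = x + - y" by transfer simp
  show "r *\<^sub>R (x + y) = r *\<^sub>R x + r *\<^sub>R y" by transfer (simp add: algebra_simps)
  show "(r + s) *\<^sub>R x = r *\<^sub>R x + s *\<^sub>R x" by transfer (simp add: algebra_simps)
  show "r *\<^sub>R s *\<^sub>R x = (r * s) *\<^sub>R x" by transfer (simp add: algebra_simps)
  show "1 *\<^sub>R x = x" by transfer simp
  show "dist x y = norm (x - y)" by (rule dist_ell2_def)
  show "sgn x = inverse (norm x) *\<^sub>R x" by (rule sgn_ell2_def)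
  show "uniformity = (INF e\<in>{0<..}. principal {(x, y :: ell2). dist x y < e})"
    by (rule uniformity_ell2_def)
  show "open U \<longleftrightarrow> (\<forall>x\<in>U. eventually (\<lambda>(x', y). x' = x \<longrightarrow> y \<in> U) uniformity)"
    for U :: "ell2 set" by (rule open_ell2_def)
  show "inner x y = inner y x"
    unfolding inner_ell2_def by (subst cinner_commute) simp
  show "inner (x + y) z = inner x z + inner y z"
  proof -
    have "cinner (x + y) z = cinner x z + cinner y z"
      unfolding cinner_def
      by (subst suminf_add[OF summable_cinner summable_cinner])
        (simp add: plus_ell2.rep_eq algebra_simps)
    then show ?thesis by (simp add: inner_ell2_def)
  qed
  show "inner (r *\<^sub>R x) y = r * inner x y"
  proof -
    have "cinner (r *\<^sub>R x) y = r * cinner x y"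
      unfolding cinner_def
      by (subst suminf_mult[OF summable_cinner, symmetric])
        (simp add: scaleR_ell2.rep_eq algebra_simps)
    then show ?thesis by (simp add: inner_ell2_def)
  qed
  show "0 \<le> inner x x"
    unfolding inner_self_ell2 by (intro suminf_nonneg summable_coord) simp
  show "inner x x = 0 \<longleftrightarrow> x = 0"
    unfolding inner_self_ell2
    by (subst suminf_eq_zero_iff[OF summable_coord])
      (auto intro!: ell2_eqI simp: zero_ell2.rep_eq)
  show "norm x = sqrt (inner x x)"
    unfolding inner_self_ell2 norm_ell2_def ..
qed

end

lift_definition basis_vec :: "nat \<Rightarrow> ell2" is "\<lambda>n m. if m = n then 1 else 0"
proof -
  fix n :: nat
  show "summable (\<lambda>m. (cmod (if m = n then 1 else 0))\<^sup>2)"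
    by (rule summable_finite[of "{n}"]) auto
qed

lemma cinner_basis_vec: "cinner x (basis_vec n) = coord x n"
proof -
  have "cinner x (basis_vec n) = (\<Sum>m\<in>{n}. coord x m * cnj (coord (basis_vec n) m))"
    unfolding cinner_def by (rule suminf_finite) (auto simp: basis_vec.rep_eq)
  then show ?thesis by (simp add: basis_vec.rep_eq)
qed

lemma basis_vec_orthonormal: "cinner (basis_vec m) (basis_vec n) = (if m = n then 1 else 0)"
  by (simp add: cinner_basis_vec basis_vec.rep_eq)

section \<open>Bounded operators and spectral measures\<close>

definition bounded_op :: "(ell2 \<Rightarrow> ell2) \<Rightarrow> bool"
  where "bounded_op T \<longleftrightarrow> bounded_linear T \<and> (\<forall>c x. T (c *\<^sub>c x) = c *\<^sub>c T x)"

definition self_adjoint :: "(ell2 \<Rightarrow> ell2) \<Rightarrow> bool"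
  where "self_adjoint T \<longleftrightarrow> (\<forall>x y. cinner (T x) y = cinner x (T y))"

definition orthogonal_projection :: "(ell2 \<Rightarrow> ell2) \<Rightarrow> bool"
  where "orthogonal_projection P \<longleftrightarrow> bounded_op P \<and> self_adjoint P \<and> (\<forall>x. P (P x) = P x)"

definition projection_valued_measure :: "(real set \<Rightarrow> ell2 \<Rightarrow> ell2) \<Rightarrow> bool"
  where "projection_valued_measure E \<longleftrightarrow>
    (\<forall>A\<in>sets borel. orthogonal_projection (E A)) \<and>
    (\<forall>x. E {} x = 0) \<and> (\<forall>x. E UNIV x = x) \<and>
    (\<forall>A\<in>sets borel. \<forall>B\<in>sets borel. \<forall>x. E (A \<inter> B) x = E A (E B x)) \<and>
    (\<forall>A :: nat \<Rightarrow> real set. range A \<subseteq> sets borel \<longrightarrow> disjoint_family A \<longrightarrow>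
      (\<forall>x. (\<lambda>n. E (A n) x) sums E (\<Union>n. A n) x))"

text \<open>The Borel measure \<open>d(E(\<lambda>)x, x)\<close>.\<close>

definition scalar_measure :: "(real set \<Rightarrow> ell2 \<Rightarrow> ell2) \<Rightarrow> ell2 \<Rightarrow> real measure"
  where "scalar_measure E x =
    measure_of UNIV (sets borel) (\<lambda>A. ennreal (Re (cinner (E A x) x)))"

text \<open>
  \<open>T = \<integral> \<lambda> dE(\<lambda>)\<close> for an everywhere defined \<open>T\<close>: the domain
  \<open>{x. \<integral> \<lambda>\<^sup>2 d(E(\<lambda>)x, x) < \<infinity>}\<close> of the integral is the whole space, and
  \<open>(T x, x) = \<integral> \<lambda> d(E(\<lambda>)x, x)\<close> for all \<open>x\<close>, which by polarization determines \<open>T\<close>.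
\<close>

definition is_spectral_measure :: "(ell2 \<Rightarrow> ell2) \<Rightarrow> (real set \<Rightarrow> ell2 \<Rightarrow> ell2) \<Rightarrow> bool"
  where "is_spectral_measure T E \<longleftrightarrow> projection_valued_measure E \<and>
    (\<forall>x. integrable (scalar_measure E x) (\<lambda>t. t\<^sup>2) \<and>
         cinner (T x) x = complex_of_real (\<integral>t. t \<partial>scalar_measure E x))"

lemma sets_scalar_measure [simp, measurable_cong]: "sets (scalar_measure E x) = sets borel"
  unfolding scalar_measure_def
  by (metis sets.sets_measure_of_eq space_borel)

lemma emeasure_scalar_measure:
  assumes E: "projection_valued_measure E" and A: "A \<in> sets borel"
  shows "emeasure (scalar_measure E x) A = ennreal (Re (cinner (E A x) x))"
proof (rule emeasure_measure_of[OF scalar_measure_def])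
  have nonneg: "0 \<le> inner (E B x) x" if "B \<in> sets borel" for B
  proof -
    have "orthogonal_projection (E B)"
      using E that by (auto simp: projection_valued_measure_def)
    then have "cinner (E B x) x = cinner (E B x) (E B x)"
      unfolding orthogonal_projection_def self_adjoint_def by metis
    then show ?thesis by (metis inner_ell2_def inner_ge_zero)
  qed
  show "sets borel \<subseteq> Pow (UNIV :: real set)" by simp
  show "A \<in> sets (scalar_measure E x)" using A by simp
  have "E {} x = 0" using E by (simp add: projection_valued_measure_def)
  then show "positive (sets (scalar_measure E x)) (\<lambda>A. ennreal (Re (cinner (E A x) x)))"
    unfolding positive_def inner_ell2_def[symmetric] by simp
  show "countably_additive (sets (scalar_measure E x)) (\<lambda>A. ennreal (Re (cinner (E A x) x)))"
    unfolding countably_additive_def inner_ell2_def[symmetric] sets_scalar_measure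
  proof (intro allI impI)
    fix B :: "nat \<Rightarrow> real set"
    assume B: "range B \<subseteq> sets borel" "disjoint_family B"
    then have "(\<lambda>n. E (B n) x) sums E (\<Union>n. B n) x"
      using E by (simp add: projection_valued_measure_def)
    then have "(\<lambda>n. inner (E (B n) x) x) sums inner (E (\<Union>n. B n) x) x"
      by (rule bounded_linear.sums[OF bounded_linear_inner_left])
    then show "(\<Sum>n. ennreal (inner (E (B n) x) x)) = ennreal (inner (E (\<Union>n. B n) x) x)"
      using B nonneg by (intro suminf_ennreal_eq) auto
  qed
qed

section \<open>The operators \<open>H\<^sub>a\<close>\<close>

text \<open>
  The matrix of \<open>H\<^sub>a\<close> is applied coordinatewise; \<open>jacobi_op_basis_vec\<close> and
  \<open>jacobi_op_unique\<close> below show that this is the operator with the prescribed action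
  on the basis.
\<close>

lift_definition jacobi_op :: "real \<Rightarrow> ell2 \<Rightarrow> ell2" is
  "\<lambda>a x n. if n = 0 then complex_of_real (a / 2) * x 1
           else if n = 1 then (complex_of_real a * x 0 + x 2) / 2
           else (x (n - 1) + x (n + 1)) / 2"
proof -
  fix a :: real and x :: "nat \<Rightarrow> complex"
  assume x: "summable (\<lambda>n. (cmod (x n))\<^sup>2)"
  have "summable (\<lambda>n. (cmod (x (n + 1)))\<^sup>2)" "summable (\<lambda>n. (cmod (x (n + 3)))\<^sup>2)"
    using x summable_iff_shift[of "\<lambda>n. (cmod (x n))\<^sup>2"] by blast+
  then have "summable (\<lambda>n. (cmod (1 / 2 * (x (n + 1) + x (n + 3))))\<^sup>2)"
    by (intro summable_cmod_squared_mult summable_cmod_squared_add)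
  moreover have "(\<lambda>n. (cmod (1 / 2 * (x (n + 1) + x (n + 3))))\<^sup>2) =
    (\<lambda>n. (cmod (if n + 2 = 0 then complex_of_real (a / 2) * x 1
           else if n + 2 = 1 then (complex_of_real a * x 0 + x 2) / 2
           else (x (n + 2 - 1) + x (n + 2 + 1)) / 2))\<^sup>2)"
    by (simp add: numeral_eq_Suc)
  ultimately show "summable (\<lambda>n. (cmod (if n = 0 then complex_of_real (a / 2) * x 1
           else if n = 1 then (complex_of_real a * x 0 + x 2) / 2
           else (x (n - 1) + x (n + 1)) / 2))\<^sup>2)"
    by (subst summable_iff_shift[of _ 2, symmetric]) simp
qed

lemma jacobi_op_basis_vec:
  shows "jacobi_op a (basis_vec 0) = (a / 2) *\<^sub>R basis_vec 1"
    and "jacobi_op a (basis_vec 1) = (1 / 2) *\<^sub>R (a *\<^sub>R basis_vec 0 + basis_vec 2)"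
    and "n \<ge> 2 \<Longrightarrow>
      jacobi_op a (basis_vec n) = (1 / 2) *\<^sub>R (basis_vec (n - 1) + basis_vec (n + 1))"
  by (rule ell2_eqI; auto simp: jacobi_op.rep_eq basis_vec.rep_eq scaleR_ell2.rep_eq
        plus_ell2.rep_eq)+

lemma jacobi_op_bounded: "bounded_op (jacobi_op a)"
proof -
  have add: "jacobi_op a (x + y) = jacobi_op a x + jacobi_op a y" for x y
    by (rule ell2_eqI) (simp add: jacobi_op.rep_eq plus_ell2.rep_eq field_simps)
  have scale: "jacobi_op a (c *\<^sub>c x) = c *\<^sub>c jacobi_op a x" for c x
    by (rule ell2_eqI) (simp add: jacobi_op.rep_eq cscale.rep_eq field_simps)
  define K where "K = 2 + a\<^sup>2"
  have bound: "norm (jacobi_op a x) \<le> norm x * sqrt (2 * K)" for x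
  proof -
    let ?f = "\<lambda>n. (cmod (coord x n))\<^sup>2" and ?h = "\<lambda>n. (cmod (coord (jacobi_op a x) n))\<^sup>2"
    define g where "g n = (if n = 0 then 0 else ?f (n - 1))" for n
    have g_Suc: "(\<lambda>n. g (Suc n)) = ?f" by (simp add: g_def)
    have g: "summable g" using summable_coord[of x] summable_Suc_iff[of g] g_Suc by simp
    have sg: "suminf g = suminf ?f"
      using suminf_split_head[OF g] by (simp add: g_Suc g_def)
    have fS: "summable (\<lambda>n. ?f (Suc n))" using summable_coord[of x] summable_Suc_iff[of ?f] by simp
    have sf: "(\<Sum>n. ?f (Suc n)) \<le> suminf ?f"
      using suminf_split_head[OF summable_coord[of x]] by simp
    have K: "K \<ge> 2" "K \<ge> a\<^sup>2" "K \<ge> 0" by (auto simp: K_def)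
    have half: "(cmod ((u + v) / 2))\<^sup>2 \<le> (cmod u)\<^sup>2 + (cmod v)\<^sup>2" for u v
    proof -
      have "(cmod ((u + v) / 2))\<^sup>2 = (cmod (u + v))\<^sup>2 / 4"
        by (simp add: norm_divide power_divide)
      moreover have "0 \<le> (cmod u)\<^sup>2" "0 \<le> (cmod v)\<^sup>2" by simp_all
      ultimately show ?thesis using cmod_add_squared_le[of u v] by linarith
    qed
    have mono: "u \<le> K * u" if "u \<ge> 0" for u
      using mult_right_mono[OF K(1) that] that by linarith
    have pt: "?h n \<le> K * (g n + ?f (Suc n))" for n
    proof -
      consider "n = 0" | "n = 1" | m where "n = Suc (Suc m)"
        by (metis One_nat_def not0_implies_Suc)
      then show ?thesis
      proof cases
        case 1
        have "?h n = a\<^sup>2 / 4 * ?f 1"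
          using 1 by (simp add: jacobi_op.rep_eq norm_mult power_mult_distrib norm_divide power_divide)
        also have "\<dots> \<le> K * ?f 1"
          using K zero_le_power2[of a] by (intro mult_right_mono) (linarith, simp)
        finally show ?thesis using 1 by (simp add: g_def)
      next
        case 2
        have "?h n \<le> (cmod (complex_of_real a * coord x 0))\<^sup>2 + ?f 2"
          using 2 half by (simp add: jacobi_op.rep_eq)
        also have "(cmod (complex_of_real a * coord x 0))\<^sup>2 = a\<^sup>2 * ?f 0"
          by (simp add: norm_mult power_mult_distrib)
        also have "a\<^sup>2 * ?f 0 + ?f 2 \<le> K * ?f 0 + K * ?f 2"
          using K by (intro add_mono mult_right_mono mono) auto
        finally show ?thesis using 2 by (simp add: g_def algebra_simps numeral_2_eq_2)
      next
        case 3
        have "?h n \<le> ?f (Suc m) + ?f (Suc n)"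
          using 3 half by (simp add: jacobi_op.rep_eq)
        also have "\<dots> \<le> K * (?f (Suc m) + ?f (Suc n))" by (intro mono) simp
        finally show ?thesis using 3 by (simp add: g_def)
      qed
    qed
    have "suminf ?h \<le> (\<Sum>n. K * (g n + ?f (Suc n)))"
      by (intro suminf_le pt summable_coord summable_mult summable_add g fS)
    also have "\<dots> = K * (suminf g + (\<Sum>n. ?f (Suc n)))"
      by (subst suminf_mult[OF summable_add[OF g fS]], subst suminf_add[OF g fS]) simp
    also have "\<dots> \<le> K * (2 * suminf ?f)"
      using sg sf K by (intro mult_left_mono) auto
    finally have "sqrt (suminf ?h) \<le> sqrt (suminf ?f * (2 * K))"
      by (intro real_sqrt_le_mono) (simp add: algebra_simps)
    then show ?thesis by (simp only: norm_ell2_def real_sqrt_mult)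
  qed
  have "bounded_linear (jacobi_op a)"
  proof (rule bounded_linear_intro[OF add _ bound])
    show "jacobi_op a (r *\<^sub>R x) = r *\<^sub>R jacobi_op a x" for r x
      by (rule ell2_eqI) (simp add: jacobi_op.rep_eq scaleR_ell2.rep_eq field_simps)
  qed
  then show ?thesis by (simp add: bounded_op_def scale)
qed

lemma ell2_expansion: "(\<lambda>n. coord x n *\<^sub>c basis_vec n) sums x"
proof -
  have partial: "coord (\<Sum>n<N. coord x n *\<^sub>c basis_vec n) m = (if m < N then coord x m else 0)"
    for N m
  proof (induction N)
    case 0
    show ?case by (simp add: zero_ell2.rep_eq)
  next
    case (Suc N)
    then show ?case
      by (auto simp: plus_ell2.rep_eq cscale.rep_eq basis_vec.rep_eq less_Suc_eq)
  qed
  let ?f = "\<lambda>n. (cmod (coord x n))\<^sup>2"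
  let ?S = "\<lambda>N. \<Sum>n<N. coord x n *\<^sub>c basis_vec n"
  have norm_eq: "norm (?S N - x) = sqrt (\<Sum>n. ?f (n + N))" for N
  proof -
    let ?g = "\<lambda>m. (cmod (coord (?S N - x) m))\<^sup>2"
    have "suminf ?g = (\<Sum>n. ?g (n + N)) + (\<Sum>n<N. ?g n)"
      by (rule suminf_split_initial_segment[OF summable_coord])
    also have "\<dots> = (\<Sum>n. ?f (n + N))"
      by (simp add: minus_ell2.rep_eq partial)
    finally show ?thesis by (simp add: norm_ell2_def)
  qed
  have "(\<lambda>N. \<Sum>n. ?f (n + N)) \<longlonglongrightarrow> 0"
    by (rule suminf_exist_split2[OF summable_coord])
  then have "(\<lambda>N. norm (?S N - x)) \<longlonglongrightarrow> 0"
    unfolding norm_eq using tendsto_real_sqrt by fastforce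
  then show ?thesis
    unfolding sums_def by (rule LIM_zero_cancel[OF tendsto_norm_zero_cancel])
qed

lemma bounded_op_eqI:
  assumes "bounded_op S" "bounded_op T" "\<And>n. S (basis_vec n) = T (basis_vec n)"
  shows "S = T"
proof
  fix x
  have R: "(\<lambda>n. coord x n *\<^sub>c R (basis_vec n)) sums R x" if "bounded_op R" for R
  proof -
    have "bounded_linear R" using that by (simp add: bounded_op_def)
    from bounded_linear.sums[OF this ell2_expansion[of x]] show ?thesis
      using that by (simp add: bounded_op_def)
  qed
  have "(\<lambda>n. coord x n *\<^sub>c T (basis_vec n)) sums S x"
    using R[OF assms(1)] by (simp add: assms(3))
  then show "S x = T x" using R[OF assms(2)] by (rule sums_unique2)
qed

lemma jacobi_op_unique:
  assumes "bounded_op T"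
    and "T (basis_vec 0) = (a / 2) *\<^sub>R basis_vec 1"
    and "T (basis_vec 1) = (1 / 2) *\<^sub>R (a *\<^sub>R basis_vec 0 + basis_vec 2)"
    and "\<And>n. n \<ge> 2 \<Longrightarrow> T (basis_vec n) = (1 / 2) *\<^sub>R (basis_vec (n - 1) + basis_vec (n + 1))"
  shows "T = jacobi_op a"
proof (rule bounded_op_eqI[OF assms(1) jacobi_op_bounded])
  fix n :: nat
  consider "n = 0" | "n = 1" | "n \<ge> 2" by linarith
  then show "T (basis_vec n) = jacobi_op a (basis_vec n)"
    by cases (simp_all only: assms jacobi_op_basis_vec)
qed

lemma jacobi_op_self_adjoint: "self_adjoint (jacobi_op a)"
  unfolding self_adjoint_def
proof (intro allI)
  fix x y
  let ?H = "jacobi_op a"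
  define w where "w n = (if n = 0 then complex_of_real (a / 2) else 1 / 2)" for n :: nat
  define u where "u n = w n * coord x (Suc n) * cnj (coord y n)" for n
  define v where "v n = w n * coord x n * cnj (coord y (Suc n))" for n
  have partial: "(\<Sum>n<Suc N. coord (?H x) n * cnj (coord y n)) -
      (\<Sum>n<Suc N. coord x n * cnj (coord (?H y) n)) = u N - v N" for N
  proof (induction N)
    case 0
    show ?case by (simp add: jacobi_op.rep_eq u_def v_def w_def)
  next
    case (Suc N)
    have "coord (?H x) (Suc N) * cnj (coord y (Suc N)) -
        coord x (Suc N) * cnj (coord (?H y) (Suc N)) = (u (Suc N) - v (Suc N)) - (u N - v N)"
      by (cases N) (simp_all add: jacobi_op.rep_eq u_def v_def w_def field_simps numeral_2_eq_2)
    then show ?case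
      by (simp only: sum.lessThan_Suc[of _ "Suc N"] add_diff_add Suc.IH) simp
  qed
  have coord0: "coord z \<longlonglongrightarrow> 0" for z
  proof -
    have "(\<lambda>n. sqrt ((cmod (coord z n))\<^sup>2)) \<longlonglongrightarrow> sqrt 0"
      by (intro tendsto_real_sqrt summable_LIMSEQ_zero summable_coord)
    then show ?thesis by (simp add: tendsto_norm_zero_iff)
  qed
  have w: "w \<longlonglongrightarrow> 1 / 2"
  proof (rule Lim_transform_eventually[OF tendsto_const])
    show "\<forall>\<^sub>F n in sequentially. 1 / 2 = w n"
      using eventually_gt_at_top[of 0] by eventually_elim (simp add: w_def)
  qed
  have "u \<longlonglongrightarrow> 1 / 2 * 0 * cnj 0" "v \<longlonglongrightarrow> 1 / 2 * 0 * cnj 0"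
    unfolding u_def v_def by (intro tendsto_mult w coord0 tendsto_cnj LIMSEQ_Suc)+
  from tendsto_diff[OF this] have "(\<lambda>N. u N - v N) \<longlonglongrightarrow> 0" by simp
  moreover have "(\<lambda>N. (\<Sum>n<Suc N. coord (?H x) n * cnj (coord y n)) -
      (\<Sum>n<Suc N. coord x n * cnj (coord (?H y) n))) \<longlonglongrightarrow> cinner (?H x) y - cinner x (?H y)"
    unfolding cinner_def
    by (intro tendsto_diff LIMSEQ_Suc summable_LIMSEQ summable_cinner)
  ultimately have "cinner (?H x) y - cinner x (?H y) = 0"
    unfolding partial using LIMSEQ_unique by blast
  then show "cinner (?H x) y = cinner x (?H y)" by simp
qed

text \<open>\<open>csqrt (1 - \<zeta>\<^sup>2)\<close> is the analytic branch in the unit disc.\<close>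

lemma csqrt_branch:
  shows "(\<lambda>z. csqrt (1 - z\<^sup>2)) holomorphic_on ball 0 1"
    and "(csqrt (1 - z\<^sup>2))\<^sup>2 = 1 - z\<^sup>2"
    and "csqrt (1 - 0\<^sup>2) = 1"
proof -
  have "1 - z\<^sup>2 \<notin> \<real>\<^sub>\<le>\<^sub>0" if "z \<in> ball 0 1" for z :: complex
  proof -
    have "cmod (z\<^sup>2) < 1" using that by (simp add: norm_power power_less_one_iff)
    then have "Re (z\<^sup>2) < 1" using complex_Re_le_cmod[of "z\<^sup>2"] by linarith
    then show ?thesis by (auto simp: complex_nonpos_Reals_iff)
  qed
  then show "(\<lambda>z. csqrt (1 - z\<^sup>2)) holomorphic_on ball 0 1"
    by (intro holomorphic_intros) auto
qed simp_all

text \<open>The denominator of the generating function has no zeros in the disc of convergence.\<close>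

lemma generating_function_denominator_nonzero:
  fixes \<zeta> :: complex
  assumes a: "a > 0"
    and \<zeta>: "a \<le> sqrt 2 \<and> cmod \<zeta> < 1 \<or> a > sqrt 2 \<and> cmod \<zeta> < 2 / a\<^sup>2 * sqrt (a\<^sup>2 - 1)"
  shows "complex_of_real (a\<^sup>2) * csqrt (1 - \<zeta>\<^sup>2) + 2 - complex_of_real (a\<^sup>2) \<noteq> 0"
proof
  assume zero: "complex_of_real (a\<^sup>2) * csqrt (1 - \<zeta>\<^sup>2) + 2 - complex_of_real (a\<^sup>2) = 0"
  define c where "c = (a\<^sup>2 - 2) / a\<^sup>2"
  have "complex_of_real (a\<^sup>2) * csqrt (1 - \<zeta>\<^sup>2) = complex_of_real (a\<^sup>2) * complex_of_real c"
  proof -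
    have "a\<^sup>2 * c = a\<^sup>2 - 2" using a by (simp add: c_def)
    then have "complex_of_real (a\<^sup>2) * complex_of_real c = complex_of_real (a\<^sup>2) - 2"
      unfolding of_real_mult[symmetric] by simp
    then show ?thesis using zero by algebra
  qed
  then have c: "csqrt (1 - \<zeta>\<^sup>2) = complex_of_real c" using a by simp
  then have "1 - \<zeta>\<^sup>2 = (complex_of_real c)\<^sup>2" by (metis power2_csqrt)
  then have sq: "\<zeta>\<^sup>2 = complex_of_real (1 - c\<^sup>2)" by (simp add: algebra_simps)
  from \<zeta> show False
  proof (elim disjE conjE)
    assume "a \<le> sqrt 2" and lt: "cmod \<zeta> < 1"
    then have "a\<^sup>2 \<le> 2" using a power_mono[of a "sqrt 2" 2] by simp
    then have "c \<le> 0" using a by (simp add: c_def divide_nonpos_pos)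
    moreover have "0 \<le> c" using Re_csqrt[of "1 - \<zeta>\<^sup>2"] c by simp
    ultimately have "\<zeta>\<^sup>2 = 1" using sq by simp
    then have "(cmod \<zeta>)\<^sup>2 = 1" by (metis norm_one norm_power)
    with lt show False by (metis abs_norm_cancel abs_square_less_1 less_irrefl)
  next
    assume "a > sqrt 2" and lt: "cmod \<zeta> < 2 / a\<^sup>2 * sqrt (a\<^sup>2 - 1)"
    then have a2: "a\<^sup>2 > 2" using power_strict_mono[of "sqrt 2" a 2] by simp
    have "(cmod \<zeta>)\<^sup>2 < (2 / a\<^sup>2 * sqrt (a\<^sup>2 - 1))\<^sup>2"
      using lt by (intro power_strict_mono) auto
    also have "\<dots> = 4 * (a\<^sup>2 - 1) / (a\<^sup>2)\<^sup>2"
      using a2 by (simp add: power_mult_distrib power_divide)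
    also have "\<dots> = 1 - c\<^sup>2"
      using a by (simp add: c_def field_simps power2_eq_square)
    also have "\<dots> \<le> cmod (\<zeta>\<^sup>2)" unfolding sq norm_of_real by simp
    finally show False by (simp add: norm_power)
  qed
qed

end

theory Submission
  imports Defs "HOL-Complex_Analysis.Complex_Analysis"
begin

text \<open>
  The operator \<open>T\<close> commutes with its spectral projections, so that
  \<open>d(E(\<lambda>)Tx, x) = \<lambda> d(E(\<lambda>)x, x)\<close>; polarizing this and inducting on \<open>n\<close> gives
  \<open>(T\<^sup>n x, x) = \<integral> \<lambda>\<^sup>n d(E(\<lambda>)x, x)\<close>. For \<open>T = H\<^sub>a\<close> and small \<open>\<zeta>\<close> the
  generating function of the moments is therefore the first coordinate of
  \<open>r = (1 - \<zeta> H\<^sub>a)\<^sup>-\<^sup>1 e\<^sub>0\<close>. The three-term recurrence shows that \<open>r\<^sub>n = a r\<^sub>0 q\<^sup>n\<close> for \<open>n \<ge> 1\<close>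
  with \<open>q = (1 - \<surd>(1 - \<zeta>\<^sup>2)) / \<zeta>\<close>, and the equation at \<open>n = 0\<close> determines \<open>r\<^sub>0\<close>. The resulting
  function is holomorphic in the whole disc of the statement, and there it is the sum of its
  Taylor series.
\<close>

section \<open>Sums of measures\<close>

text \<open>An identity of signed measures \<open>M1 - M2 = N2 - N1\<close> in subtraction-free
  form, since the values may be infinite. It holds on indicators, and both sides respect positive
  multiples, sums and monotone limits of \<open>f\<close>.\<close>

lemma nn_integral_add_measures_eq:
  assumes sets: "sets M2 = sets M1" "sets N1 = sets M1" "sets N2 = sets M1"
    and eq: "\<And>A. A \<in> sets M1 \<Longrightarrow> emeasure M1 A + emeasure N1 A = emeasure M2 A + emeasure N2 A"
    and f: "f \<in> borel_measurable M1"
  shows "nn_integral M1 f + nn_integral N1 f = nn_integral M2 f + nn_integral N2 f"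
proof -
  note [measurable_cong] = sets
  note sp = sets[THEN sets_eq_imp_space_eq]
  show ?thesis
    using f
  proof (induct rule: borel_measurable_induct)
    case (cong f g)
    have "nn_integral M f = nn_integral M g" if "space M = space M1" for M
      using cong that by (intro nn_integral_cong) simp
    then show ?case using cong sp by simp
  next
    case (set A)
    then show ?case using eq sets by simp
  next
    case (mult u c)
    note [measurable] = mult(2)
    show ?case using mult(4) by (simp add: nn_integral_cmult distrib_left[symmetric])
  next
    case (add u v)
    note [measurable] = add(1,4)
    show ?case using arg_cong2[OF add(7) add(3), of "(+)"] by (simp add: nn_integral_add add_ac)
  next
    case (seq U)
    note [measurable] = seq(1)
    have inc: "incseq (\<lambda>i. nn_integral M (U i))" for M
      using seq(4) by (auto simp: incseq_def le_fun_def intro!: nn_integral_mono)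
    have SUP: "nn_integral M (\<lambda>x. SUP i. U i x) = (SUP i. nn_integral M (U i))"
      if "sets M = sets M1" for M
      using seq(1,4) that
      by (intro nn_integral_monotone_convergence_SUP) (auto cong: measurable_cong_sets)
    show ?case
      by (simp add: SUP sets SUP_apply image_comp seq(3) ennreal_SUP_add[OF inc inc, symmetric])
  qed
qed

text \<open>The positive and negative parts of \<open>f\<close> are treated separately;
  integrability makes all eight integrals finite, so they can be moved from \<open>ennreal\<close>
  to the reals.\<close>

lemma integral_add_measures_eq:
  fixes f :: "'a \<Rightarrow> real"
  assumes sets: "sets M2 = sets M1" "sets N1 = sets M1" "sets N2 = sets M1"
    and eq: "\<And>A. A \<in> sets M1 \<Longrightarrow> emeasure M1 A + emeasure N1 A = emeasure M2 A + emeasure N2 A"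
    and int: "integrable M1 f" "integrable N1 f" "integrable M2 f" "integrable N2 f"
  shows "integral\<^sup>L M1 f + integral\<^sup>L N1 f = integral\<^sup>L M2 f + integral\<^sup>L N2 f"
proof -
  have [measurable]: "f \<in> borel_measurable M1" using int by simp
  have *: "enn2real (nn_integral M1 (\<lambda>x. ennreal (g x))) + enn2real (nn_integral N1 (\<lambda>x. ennreal (g x)))
      = enn2real (nn_integral M2 (\<lambda>x. ennreal (g x))) + enn2real (nn_integral N2 (\<lambda>x. ennreal (g x)))"
    if [measurable]: "g \<in> borel_measurable M1" and
      fin: "\<And>M. M \<in> {M1, N1, M2, N2} \<Longrightarrow> nn_integral M (\<lambda>x. ennreal (g x)) < top" for g :: "'a \<Rightarrow> real"
    using nn_integral_add_measures_eq[OF sets eq, of "\<lambda>x. ennreal (g x)"] fin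
    by (simp add: enn2real_plus[symmetric])
  have fin: "nn_integral M (\<lambda>x. ennreal (f x)) < top" "nn_integral M (\<lambda>x. ennreal (- f x)) < top"
    if "M \<in> {M1, N1, M2, N2}" for M
    using int that by (auto simp: real_integrable_def less_top)
  show ?thesis
    using *[of f] *[of "\<lambda>x. - f x"] fin by (simp add: int real_lebesgue_integral_def)
qed

section \<open>Moments of a spectral measure\<close>

lemma self_adjoint_inner: "self_adjoint T \<Longrightarrow> inner (T x) y = inner x (T y)"
  by (simp add: self_adjoint_def inner_ell2_def)

lemma self_adjoint_funpow: "self_adjoint T \<Longrightarrow> self_adjoint (T ^^ n)"
  by (induction n) (auto simp: self_adjoint_def funpow_swap1)

text \<open>Symmetry makes the two cross terms equal. Two vectors suffice although the space is
  complex, because \<open>inner\<close> is the real part of the scalar product.\<close>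

lemma inner_polarization_self_adjoint:
  assumes "linear T" "self_adjoint T"
  shows "inner (T (x + y)) (x + y) - inner (T (x - y)) (x - y) = 4 * inner (T x) y"
proof -
  have "inner (T y) x = inner (T x) y"
    using self_adjoint_inner[OF assms(2), of y x] by (simp add: inner_commute)
  then show ?thesis
    by (simp add: linear_add[OF assms(1)] linear_diff[OF assms(1)] inner_add inner_diff)
qed

section \<open>A self-adjoint operator and its spectral projections\<close>

context
  fixes T :: "ell2 \<Rightarrow> ell2" and E :: "real set \<Rightarrow> ell2 \<Rightarrow> ell2"
  assumes bounded: "bounded_op T" and sa: "self_adjoint T" and spec: "is_spectral_measure T E"
begin

lemma pvm: "projection_valued_measure E"
  using spec by (simp add: is_spectral_measure_def)

lemma linear_T: "linear T"
  using bounded by (simp add: bounded_op_def bounded_linear.linear)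

lemma linear_E: "A \<in> sets borel \<Longrightarrow> linear (E A)"
  using pvm by (auto simp: projection_valued_measure_def orthogonal_projection_def bounded_op_def
      bounded_linear.linear)

lemma self_adjoint_E: "A \<in> sets borel \<Longrightarrow> self_adjoint (E A)"
  using pvm by (auto simp: projection_valued_measure_def orthogonal_projection_def)

lemma E_Int: "A \<in> sets borel \<Longrightarrow> B \<in> sets borel \<Longrightarrow> E A (E B x) = E (A \<inter> B) x"
  using pvm by (simp add: projection_valued_measure_def)

lemma inner_E_nonneg: "A \<in> sets borel \<Longrightarrow> 0 \<le> inner (E A x) x"
  using E_Int[of A A x] self_adjoint_inner[OF self_adjoint_E, of A "E A x" x]
  by (metis Int_absorb inner_ge_zero)

lemma emeasure_scalar:
  "A \<in> sets borel \<Longrightarrow> emeasure (scalar_measure E x) A = ennreal (inner (E A x) x)"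
  using emeasure_scalar_measure[OF pvm] by (simp add: inner_ell2_def)

lemma space_scalar [simp]: "space (scalar_measure E x) = UNIV"
  using sets_eq_imp_space_eq[OF sets_scalar_measure] by simp

lemma finite_scalar: "finite_measure (scalar_measure E x)"
  by (rule finite_measureI) (simp add: emeasure_scalar)

lemma measure_scalar_UNIV: "measure (scalar_measure E x) UNIV = inner x x"
  using pvm by (simp add: measure_def emeasure_scalar projection_valued_measure_def)

lemma integrable_scalar_id: "integrable (scalar_measure E x) (\<lambda>t. t)"
proof -
  interpret finite_measure "scalar_measure E x" by (rule finite_scalar)
  \<comment> \<open>The dominating function combines finiteness of the measure with the second
    moment granted by the definition of a spectral measure.\<close>
  have *: "integrable (scalar_measure E x) (\<lambda>t. 1 + t\<^sup>2)"
    using spec by (simp add: is_spectral_measure_def)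
  show ?thesis
  proof (rule Bochner_Integration.integrable_bound[OF *])
    show "AE t in scalar_measure E x. norm t \<le> norm (1 + t\<^sup>2)"
    proof (rule AE_I2)
      fix t :: real
      have "2 * \<bar>t\<bar> \<le> 1 + t\<^sup>2" using sum_squares_bound[of 1 "\<bar>t\<bar>"] by simp
      then show "norm t \<le> norm (1 + t\<^sup>2)" by simp
    qed
  qed simp
qed

lemma inner_T_self: "inner (T x) x = (\<integral>t. t \<partial>scalar_measure E x)"
  using spec by (simp add: is_spectral_measure_def inner_ell2_def)

text \<open>
  For \<open>u\<close> in the range of \<open>E A\<close> and \<open>v\<close> orthogonal to it the cross terms in
  \<open>(E(B)(u \<plusminus> v), u \<plusminus> v)\<close> vanish, so the quadratic form of \<open>T\<close> has the same value at
  \<open>u + v\<close> and \<open>u - v\<close>.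
\<close>
lemma T_preserves_range:
  assumes A: "A \<in> sets borel"
  shows "E A (T (E A x)) = T (E A x)"
proof -
  have orth: "inner (T (E A x)) (y - E A y) = 0" for y
  proof -
    let ?u = "E A x" and ?v = "y - E A y"
    have cross: "inner (E B ?u) ?v = 0" if B: "B \<in> sets borel" for B
    proof -
      \<comment> \<open>The projections commute, so \<open>E B\<close> keeps \<open>?u\<close> in
        the range of \<open>E A\<close>.\<close>
      have "E B ?u = E A (E B ?u)" using A B by (simp add: E_Int Int_ac)
      then show ?thesis
        using self_adjoint_inner[OF self_adjoint_E[OF A], of "E B ?u" y] by (simp add: inner_diff)
    qed
    have "scalar_measure E (?u + ?v) = scalar_measure E (?u - ?v)"
    proof (rule measure_eqI)
      fix B assume "B \<in> sets (scalar_measure E (?u + ?v))"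
      then have B: "B \<in> sets borel" by simp
      then show "emeasure (scalar_measure E (?u + ?v)) B = emeasure (scalar_measure E (?u - ?v)) B"
        using inner_polarization_self_adjoint[OF linear_E[OF B] self_adjoint_E[OF B], of ?u ?v] cross
        by (simp add: emeasure_scalar)
    qed simp
    then show ?thesis
      using inner_polarization_self_adjoint[OF linear_T sa, of ?u ?v] by (simp add: inner_T_self)
  qed
  let ?w = "T (E A x)"
  have "inner (?w - E A ?w) y = 0" for y
    using orth[of y] self_adjoint_inner[OF self_adjoint_E[OF A], of ?w y] by (simp add: inner_diff)
  then have "?w - E A ?w = 0" by (metis inner_eq_zero_iff)
  then show ?thesis by simp
qed

text \<open>Since \<open>T\<close> maps the range of \<open>E A\<close> into itself, the left side
  is the quadratic form of \<open>T\<close> at \<open>E A x\<close>; the scalar measure of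
  \<open>E A x\<close> is that of \<open>x\<close> restricted to \<open>A\<close>.\<close>

lemma inner_E_T:
  assumes A: "A \<in> sets borel"
  shows "inner (E A (T x)) x = (\<integral>t. indicator A t * t \<partial>scalar_measure E x)"
proof -
  have "inner (E A (T x)) x = inner x (T (E A x))"
    using A by (simp add: self_adjoint_inner[OF self_adjoint_E] self_adjoint_inner[OF sa])
  also have "\<dots> = inner (E A x) (T (E A x))"
    using A by (metis T_preserves_range self_adjoint_inner self_adjoint_E)
  also have "\<dots> = (\<integral>t. t \<partial>scalar_measure E (E A x))"
    by (simp add: inner_T_self[symmetric] inner_commute)
  also have "scalar_measure E (E A x) = density (scalar_measure E x) (indicator A)"
  proof (rule measure_eqI)
    fix B assume "B \<in> sets (scalar_measure E (E A x))"
    then have B: "B \<in> sets borel" by simp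
    have "inner (E B (E A x)) (E A x) = inner (E A (E B (E A x))) x"
      using A by (simp add: self_adjoint_inner[OF self_adjoint_E])
    also have "\<dots> = inner (E (A \<inter> B) x) x"
      using A B by (simp add: E_Int Int_ac)
    finally show "emeasure (scalar_measure E (E A x)) B =
        emeasure (density (scalar_measure E x) (indicator A)) B"
      using A B by (simp add: emeasure_scalar emeasure_restricted)
  qed simp
  also have "(\<integral>t. t \<partial>\<dots>) = (\<integral>t. indicator A t * t \<partial>scalar_measure E x)"
    using A integral_density[of "\<lambda>t. t" "scalar_measure E x" "indicator A"]
    by (simp add: ennreal_indicator)
  finally show ?thesis .
qed

text \<open>
  The polarized form of \<open>d(E(\<lambda>)Tx, x) = \<lambda> d(E(\<lambda>)x, x)\<close>, with the negative terms moved to the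
  other side so that both sides are positive measures.
\<close>
lemma emeasure_scalar_polarization:
  assumes A: "A \<in> sets borel"
  shows "emeasure (scalar_measure E (T x + x)) A +
      emeasure (density (scalar_measure E x) (\<lambda>t. ennreal (4 * max 0 (- t)))) A =
    emeasure (scalar_measure E (T x - x)) A +
      emeasure (density (scalar_measure E x) (\<lambda>t. ennreal (4 * max 0 t))) A"
proof -
  let ?\<mu> = "scalar_measure E x"
  have int: "integrable ?\<mu> (\<lambda>t. indicator A t * (4 * max 0 t))"
    "integrable ?\<mu> (\<lambda>t. indicator A t * (4 * max 0 (- t)))"
    using A integrable_scalar_id[of x]
    by (subst mult.commute, auto intro!: integrable_real_mult_indicator)+
  have dens: "emeasure (density ?\<mu> (\<lambda>t. ennreal (g t))) A = ennreal (\<integral>t. indicator A t * g t \<partial>?\<mu>)"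
    if "integrable ?\<mu> (\<lambda>t. indicator A t * g t)" "\<And>t. 0 \<le> g t" "g \<in> borel_measurable borel" for g
  proof -
    have "emeasure (density ?\<mu> (\<lambda>t. ennreal (g t))) A = (\<integral>\<^sup>+t. ennreal (indicator A t * g t) \<partial>?\<mu>)"
      using A that by (subst emeasure_density) (auto intro!: nn_integral_cong simp: indicator_def)
    then show ?thesis using that by (simp add: nn_integral_eq_integral)
  qed
  \<comment> \<open>As \<open>max 0 t - max 0 (- t) = t\<close>, the two weights differ by the
    signed density \<open>4 * t\<close>, to which \<open>inner_E_T\<close> applies.\<close>
  have "(\<integral>t. indicator A t * (4 * max 0 t) \<partial>?\<mu>) - (\<integral>t. indicator A t * (4 * max 0 (- t)) \<partial>?\<mu>)
      = (\<integral>t. 4 * (indicator A t * t) \<partial>?\<mu>)"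
    unfolding Bochner_Integration.integral_diff[OF int, symmetric]
    by (intro Bochner_Integration.integral_cong) (auto simp: indicator_def max_def)
  also have "\<dots> = 4 * inner (E A (T x)) x" by (simp add: inner_E_T[OF A])
  also have "\<dots> = inner (E A (T x + x)) (T x + x) - inner (E A (T x - x)) (T x - x)"
    using A by (simp add: inner_polarization_self_adjoint linear_E self_adjoint_E)
  finally show ?thesis
    using A inner_E_nonneg[OF A]
    by (simp add: emeasure_scalar dens int flip: ennreal_plus)
qed

text \<open>The induction covers all vectors at once: the polarized identity controls degree
  \<open>n + 1\<close> at \<open>x\<close> by degree \<open>n\<close> at \<open>T x + x\<close> and
  \<open>T x - x\<close>.\<close>

lemma integrable_scalar_power: "integrable (scalar_measure E x) (\<lambda>t. t ^ n)"
proof (induction n arbitrary: x)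
  case 0
  interpret finite_measure "scalar_measure E x" by (rule finite_scalar)
  show ?case by simp
next
  case (Suc n)
  let ?\<mu> = "scalar_measure E x"
  have fin: "(\<integral>\<^sup>+t. ennreal (\<bar>t\<bar> ^ n) * indicator A t \<partial>scalar_measure E y) < top"
    if "A \<in> sets borel" for A :: "real set" and y
  proof -
    have "(\<integral>\<^sup>+t. ennreal (\<bar>t\<bar> ^ n) * indicator A t \<partial>scalar_measure E y)
        \<le> (\<integral>\<^sup>+t. ennreal (norm (t ^ n)) \<partial>scalar_measure E y)"
      by (intro nn_integral_mono) (auto simp: indicator_def power_abs)
    then show ?thesis using Suc.IH[of y] by (simp add: integrable_iff_bounded le_less_trans)
  qed
  have polar: "nn_integral (scalar_measure E (T x + x)) f +
      (\<integral>\<^sup>+t. ennreal (4 * max 0 (- t)) * f t \<partial>?\<mu>) =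
      nn_integral (scalar_measure E (T x - x)) f + (\<integral>\<^sup>+t. ennreal (4 * max 0 t) * f t \<partial>?\<mu>)"
    if "f \<in> borel_measurable borel" for f
    using nn_integral_add_measures_eq[of "scalar_measure E (T x - x)" "scalar_measure E (T x + x)"
        "density ?\<mu> (\<lambda>t. ennreal (4 * max 0 (- t)))" "density ?\<mu> (\<lambda>t. ennreal (4 * max 0 t))" f]
      emeasure_scalar_polarization that
    by (simp add: nn_integral_density)
  \<comment> \<open>On a half-line one of the two weights vanishes, so the other is bounded by a
    single scalar measure and no difference of infinities can arise.\<close>
  have pos: "(\<integral>\<^sup>+t. ennreal (4 * max 0 t) * (ennreal (\<bar>t\<bar> ^ n) * indicator {0..} t) \<partial>?\<mu>) < top"
  proof -
    have "(\<integral>\<^sup>+t. ennreal (4 * max 0 (- t)) * (ennreal (\<bar>t\<bar> ^ n) * indicator {0..} t) \<partial>?\<mu>) = (\<integral>\<^sup>+t. 0 \<partial>?\<mu>)"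
      by (intro nn_integral_cong) (auto simp: indicator_def)
    then show ?thesis
      using polar[of "\<lambda>t. ennreal (\<bar>t\<bar> ^ n) * indicator {0..} t"] fin[of "{0..}" "T x + x"]
      by (auto simp: less_top)
  qed
  have neg: "(\<integral>\<^sup>+t. ennreal (4 * max 0 (- t)) * (ennreal (\<bar>t\<bar> ^ n) * indicator {..0} t) \<partial>?\<mu>) < top"
  proof -
    have "(\<integral>\<^sup>+t. ennreal (4 * max 0 t) * (ennreal (\<bar>t\<bar> ^ n) * indicator {..0} t) \<partial>?\<mu>) = (\<integral>\<^sup>+t. 0 \<partial>?\<mu>)"
      by (intro nn_integral_cong) (auto simp: indicator_def)
    then show ?thesis
      using polar[of "\<lambda>t. ennreal (\<bar>t\<bar> ^ n) * indicator {..0} t"] fin[of "{..0}" "T x - x"]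
      by (auto simp flip: less_top)
  qed
  \<comment> \<open>Every \<open>t\<close> lies in at least one of the half-lines, and the factor 4
    only enlarges the bound.\<close>
  have "(\<integral>\<^sup>+t. ennreal (norm (t ^ Suc n)) \<partial>?\<mu>) \<le>
      (\<integral>\<^sup>+t. ennreal (4 * max 0 t) * (ennreal (\<bar>t\<bar> ^ n) * indicator {0..} t) +
        ennreal (4 * max 0 (- t)) * (ennreal (\<bar>t\<bar> ^ n) * indicator {..0} t) \<partial>?\<mu>)"
  proof (rule nn_integral_mono)
    fix t :: real
    show "ennreal (norm (t ^ Suc n)) \<le> ennreal (4 * max 0 t) * (ennreal (\<bar>t\<bar> ^ n) * indicator {0..} t) +
        ennreal (4 * max 0 (- t)) * (ennreal (\<bar>t\<bar> ^ n) * indicator {..0} t)"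
      using mult_nonneg_nonneg[of "\<bar>t\<bar>" "\<bar>t\<bar> ^ n"]
      by (auto simp: indicator_def power_abs abs_mult ennreal_mult[symmetric] max_def
          intro!: ennreal_leI)
  qed
  also have "\<dots> < top"
    using pos neg by (subst nn_integral_add) auto
  finally show ?case by (simp add: integrable_iff_bounded)
qed

text \<open>Integrating \<open>t ^ n\<close> against the polarized identity leaves the weight
  \<open>4 * t ^ Suc n\<close>; by induction the other terms are the polarized form of
  \<open>T ^^ n\<close> at \<open>T x\<close> and \<open>x\<close>.\<close>

lemma integral_scalar_power: "(\<integral>t. t ^ n \<partial>scalar_measure E x) = inner ((T ^^ n) x) x"
proof (induction n arbitrary: x)
  case 0
  show ?case by (simp add: measure_scalar_UNIV)
next
  case (Suc n)
  let ?\<mu> = "scalar_measure E x"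
  have int: "integrable ?\<mu> (\<lambda>t. 4 * max 0 t * t ^ n)" "integrable ?\<mu> (\<lambda>t. 4 * max 0 (- t) * t ^ n)"
    by (rule Bochner_Integration.integrable_bound[OF
          integrable_mult_right[of 4, OF integrable_scalar_power[of x "Suc n"]]],
        auto intro!: AE_I2 simp: abs_mult max_def mult_nonpos_nonneg)+
  have lin: "linear (T ^^ n)"
    by (induction n) (use linear_T in \<open>simp_all add: linear_iff\<close>)
  have "(\<integral>t. t ^ n \<partial>scalar_measure E (T x + x)) + (\<integral>t. 4 * max 0 (- t) * t ^ n \<partial>?\<mu>)
      = (\<integral>t. t ^ n \<partial>scalar_measure E (T x - x)) + (\<integral>t. 4 * max 0 t * t ^ n \<partial>?\<mu>)"
    using integral_add_measures_eq[of "scalar_measure E (T x - x)" "scalar_measure E (T x + x)"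
        "density ?\<mu> (\<lambda>t. ennreal (4 * max 0 (- t)))" "density ?\<mu> (\<lambda>t. ennreal (4 * max 0 t))"
        "\<lambda>t. t ^ n"] emeasure_scalar_polarization int
    by (simp add: integral_density integrable_density integrable_scalar_power)
  then have "(\<integral>t. 4 * max 0 t * t ^ n \<partial>?\<mu>) - (\<integral>t. 4 * max 0 (- t) * t ^ n \<partial>?\<mu>) =
      4 * inner ((T ^^ n) (T x)) x"
    using inner_polarization_self_adjoint[OF lin self_adjoint_funpow[OF sa], of "T x" x]
    by (simp add: Suc.IH)
  moreover have "(\<integral>t. 4 * max 0 t * t ^ n \<partial>?\<mu>) - (\<integral>t. 4 * max 0 (- t) * t ^ n \<partial>?\<mu>) =
      (\<integral>t. 4 * t ^ Suc n \<partial>?\<mu>)"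
    unfolding Bochner_Integration.integral_diff[OF int, symmetric]
    by (intro Bochner_Integration.integral_cong) (auto simp: max_def)
  ultimately show ?case by (simp add: funpow_swap1)
qed

text \<open>The real inner product sees only the real part; self-adjointness of the power makes the
  imaginary part vanish.\<close>

lemma cinner_funpow_self:
  "cinner ((T ^^ n) x) x = complex_of_real (\<integral>t. t ^ n \<partial>scalar_measure E x)"
proof -
  have "cinner ((T ^^ n) x) x = cnj (cinner ((T ^^ n) x) x)"
    using self_adjoint_funpow[OF sa, of n] cinner_commute[of "(T ^^ n) x" x]
    by (simp add: self_adjoint_def)
  then show ?thesis
    by (simp add: integral_scalar_power inner_ell2_def complex_eq_iff)
qed

end

section \<open>The generating function\<close>

definition gen_fun :: "real \<Rightarrow> complex \<Rightarrow> complex" where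
  "gen_fun a \<zeta> = 2 / (complex_of_real (a\<^sup>2) * csqrt (1 - \<zeta>\<^sup>2) + 2 - complex_of_real (a\<^sup>2))"

lemma norm_coord_le: "cmod (coord x n) \<le> norm x"
proof -
  have "(cmod (coord x n))\<^sup>2 \<le> (\<Sum>n. (cmod (coord x n))\<^sup>2)"
    using sum_le_suminf[OF summable_coord, of "{n}" x] by simp
  then show ?thesis by (simp add: norm_ell2_def real_le_rsqrt)
qed

text \<open>The solution of \<open>(1 - \<zeta> H) r = e_0\<close> is written down explicitly and
  checked row by row, with no bound on the norm of \<open>H\<close>.\<close>

lemma resolvent_jacobi_op:
  fixes \<zeta> :: complex
  assumes \<zeta>: "cmod \<zeta> < 1"
    and nz: "complex_of_real (a\<^sup>2) * csqrt (1 - \<zeta>\<^sup>2) + 2 - complex_of_real (a\<^sup>2) \<noteq> 0"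
  obtains r where "coord r 0 = gen_fun a \<zeta>" "r = \<zeta> *\<^sub>c jacobi_op a r + basis_vec 0"
proof -
  define s where "s = csqrt (1 - \<zeta>\<^sup>2)"
  \<comment> \<open>the root of \<open>q = \<zeta> (1 + q\<^sup>2) / 2\<close> in the unit disc, in a form that is defined at \<open>\<zeta> = 0\<close>\<close>
  define q where "q = \<zeta> / (1 + s)"
  define R where "R = gen_fun a \<zeta>"
  have s2: "s\<^sup>2 = 1 - \<zeta>\<^sup>2" by (simp add: s_def)
  \<comment> \<open>The branch with nonnegative real part gives \<open>cmod (1 + s) \<ge> 1\<close>,
    hence \<open>cmod q \<le> cmod \<zeta> < 1\<close> and a square-summable solution.\<close>
  have "0 \<le> Re s" unfolding s_def by (rule Re_csqrt)
  then have s1: "1 \<le> cmod (1 + s)" using complex_Re_le_cmod[of "1 + s"] by simp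
  then have s0: "1 + s \<noteq> 0" by auto
  have "cmod q \<le> cmod \<zeta>"
    using s1 mult_left_mono[of 1 "cmod (1 + s)" "cmod \<zeta>"]
    by (simp add: q_def norm_divide divide_le_eq)
  then have q1: "cmod q < 1" using \<zeta> by simp
  have q: "q = \<zeta> * (1 + q\<^sup>2) / 2"
  proof -
    have "(1 + s)\<^sup>2 + \<zeta>\<^sup>2 = 2 * (1 + s)" using s2 by (simp add: power2_eq_square algebra_simps)
    then have "1 + q\<^sup>2 = 2 * (1 + s) / (1 + s)\<^sup>2"
      using s0 by (simp add: q_def power_divide add_divide_eq_iff)
    also have "\<dots> = 2 / (1 + s)"
      unfolding power2_eq_square using s0 by (rule mult_divide_mult_cancel_right)
    finally have *: "1 + q\<^sup>2 = 2 / (1 + s)" .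
    have "2 * q = \<zeta> * (1 + q\<^sup>2)" unfolding * by (simp add: q_def)
    then show ?thesis by (simp add: mult.commute)
  qed
  have "\<zeta> * q = (1 - s) * (1 + s) / (1 + s)"
    using s2 by (simp add: q_def power2_eq_square algebra_simps)
  then have zq: "\<zeta> * q = 1 - s" using s0 by simp
  have "R * (complex_of_real (a\<^sup>2) * s + 2 - complex_of_real (a\<^sup>2)) = 2"
    unfolding R_def gen_fun_def s_def
    by (simp only: times_divide_eq_left nonzero_mult_div_cancel_right[OF nz])
  \<comment> \<open>This is row 0, where \<open>H r\<close> has the entry \<open>a / 2\<close> times
    \<open>a * R * q\<close>.\<close>
  then have R: "R = complex_of_real (a\<^sup>2) * R * (\<zeta> * q) / 2 + 1"
    unfolding zq by (simp add: field_simps)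
  \<comment> \<open>Row 1 sees \<open>a\<close> times entry 0, so from there on the sequence behaves
    like a geometric one with the value \<open>a * R\<close> at index 0.\<close>
  define f where "f n = (if n = 0 then R else complex_of_real a * R * q ^ n)" for n
  have "summable (\<lambda>n. (cmod (f n))\<^sup>2)"
  proof (subst summable_Suc_iff[symmetric])
    have "summable (\<lambda>n. (cmod (complex_of_real a * R * q))\<^sup>2 * ((cmod q)\<^sup>2) ^ n)"
      using q1 by (intro summable_mult summable_geometric) (simp add: power_less_one_iff abs_square_less_1)
    then show "summable (\<lambda>n. (cmod (f (Suc n)))\<^sup>2)"
      by (simp add: f_def norm_mult power_mult_distrib norm_power power_mult[symmetric] mult.commute mult.left_commute)
  qed
  then have coord: "coord (Ell2 f) = f" by (simp add: Ell2_inverse)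
  show ?thesis
  proof
    show "coord (Ell2 f) 0 = gen_fun a \<zeta>" by (simp add: coord f_def R_def)
    show "Ell2 f = \<zeta> *\<^sub>c jacobi_op a (Ell2 f) + basis_vec 0"
    proof (rule ell2_eqI)
      fix n :: nat
      consider "n = 0" | "n = 1" | m where "n = Suc (Suc m)"
        by (metis One_nat_def not0_implies_Suc)
      then show "coord (Ell2 f) n = coord (\<zeta> *\<^sub>c jacobi_op a (Ell2 f) + basis_vec 0) n"
      proof cases
        case 1
        then show ?thesis using R
          by (simp add: coord plus_ell2.rep_eq cscale.rep_eq jacobi_op.rep_eq basis_vec.rep_eq f_def
              power2_eq_square algebra_simps)
      next
        case 2
        have "complex_of_real a * R * q = complex_of_real a * R * (\<zeta> * (1 + q\<^sup>2) / 2)"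
          using q by metis
        then show ?thesis using 2
          by (simp add: coord plus_ell2.rep_eq cscale.rep_eq jacobi_op.rep_eq basis_vec.rep_eq f_def
              algebra_simps add_divide_distrib)
      next
        case 3
        have "\<zeta> * ((f (Suc m) + f (Suc n)) / 2) = complex_of_real a * R * q ^ Suc m * (\<zeta> * (1 + q\<^sup>2) / 2)"
          using 3 by (simp add: f_def power2_eq_square algebra_simps add_divide_distrib)
        also have "\<dots> = f n" using 3 by (simp add: f_def flip: q)
        finally show ?thesis using 3
          by (simp add: coord plus_ell2.rep_eq cscale.rep_eq jacobi_op.rep_eq basis_vec.rep_eq)
      qed
    qed
  qed
qed

text \<open>Iterating the resolvent equation gives a telescoping partial sum with remainder
  \<open>\<zeta> ^ n * coord ((H ^^ n) r) 0\<close>, which is bounded by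
  \<open>(onorm H * cmod \<zeta>) ^ n * norm r\<close>.\<close>

lemma sums_gen_fun_near_0:
  fixes \<zeta> :: complex
  assumes \<zeta>: "cmod \<zeta> < 1" "onorm (jacobi_op a) * cmod \<zeta> < 1"
    and nz: "complex_of_real (a\<^sup>2) * csqrt (1 - \<zeta>\<^sup>2) + 2 - complex_of_real (a\<^sup>2) \<noteq> 0"
  shows "(\<lambda>n. coord ((jacobi_op a ^^ n) (basis_vec 0)) 0 * \<zeta> ^ n) sums gen_fun a \<zeta>"
proof -
  let ?H = "jacobi_op a"
  obtain r where r: "coord r 0 = gen_fun a \<zeta>" "r = \<zeta> *\<^sub>c ?H r + basis_vec 0"
    using resolvent_jacobi_op[OF \<zeta>(1) nz] .
  have bl: "bounded_linear ?H" and sc: "\<And>c x. ?H (c *\<^sub>c x) = c *\<^sub>c ?H x"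
    using jacobi_op_bounded by (auto simp: bounded_op_def)
  have rn: "(?H ^^ n) r = \<zeta> *\<^sub>c (?H ^^ Suc n) r + (?H ^^ n) (basis_vec 0)" for n
  proof (induction n)
    case 0
    show ?case using r(2) by simp
  next
    case (Suc n)
    have "?H ((?H ^^ n) r) = ?H (\<zeta> *\<^sub>c (?H ^^ Suc n) r + (?H ^^ n) (basis_vec 0))"
      by (rule arg_cong[OF Suc.IH])
    also have "\<dots> = \<zeta> *\<^sub>c ?H ((?H ^^ Suc n) r) + ?H ((?H ^^ n) (basis_vec 0))"
      by (simp only: linear_add[OF bounded_linear.linear[OF bl]] sc)
    finally show ?case by simp
  qed
  have partial: "(\<Sum>k<n. coord ((?H ^^ k) (basis_vec 0)) 0 * \<zeta> ^ k) =
      gen_fun a \<zeta> - \<zeta> ^ n * coord ((?H ^^ n) r) 0" for n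
  proof (induction n)
    case 0
    show ?case by (simp add: r(1))
  next
    case (Suc n)
    have "coord ((?H ^^ n) r) 0 = \<zeta> * coord ((?H ^^ Suc n) r) 0 + coord ((?H ^^ n) (basis_vec 0)) 0"
      using arg_cong[OF rn[of n], of "\<lambda>x. coord x 0"] by (simp only: plus_ell2.rep_eq cscale.rep_eq)
    with Suc.IH show ?case by (simp add: algebra_simps del: funpow.simps)
  qed
  have bound: "norm ((?H ^^ n) r) \<le> onorm ?H ^ n * norm r" for n
  proof (induction n)
    case (Suc n)
    have "norm (?H ((?H ^^ n) r)) \<le> onorm ?H * norm ((?H ^^ n) r)" by (rule onorm[OF bl])
    also have "\<dots> \<le> onorm ?H * (onorm ?H ^ n * norm r)"
      using Suc.IH onorm_pos_le[OF bl] by (rule mult_left_mono)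
    finally show ?case by (simp add: mult.assoc)
  qed simp
  have "(\<lambda>n. \<zeta> ^ n * coord ((?H ^^ n) r) 0) \<longlonglongrightarrow> 0"
  proof (rule Lim_null_comparison)
    show "(\<lambda>n. (onorm ?H * cmod \<zeta>) ^ n * norm r) \<longlonglongrightarrow> 0"
      using \<zeta> onorm_pos_le[OF bl] by (intro tendsto_mult_left_zero LIMSEQ_realpow_zero) auto
    have "norm (\<zeta> ^ n * coord ((?H ^^ n) r) 0) \<le> (onorm ?H * cmod \<zeta>) ^ n * norm r" for n
      using mult_left_mono[OF order_trans[OF norm_coord_le bound[of n]], of "cmod \<zeta> ^ n" 0]
      by (simp add: norm_mult norm_power power_mult_distrib mult_ac)
    then show "\<forall>\<^sub>F n in sequentially.
        norm (\<zeta> ^ n * coord ((?H ^^ n) r) 0) \<le> (onorm ?H * cmod \<zeta>) ^ n * norm r" by simp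
  qed
  from tendsto_diff[OF tendsto_const[of "gen_fun a \<zeta>"] this] show ?thesis
    by (simp add: sums_def partial)
qed

section \<open>Extension from a neighbourhood of 0 to the full disc\<close>

theorem proposition5p8:
  fixes a :: real
    and E :: "real set \<Rightarrow> ell2 \<Rightarrow> ell2"
    and \<kappa> :: "nat \<Rightarrow> real"
  assumes "a > 0"
    and "is_spectral_measure (jacobi_op a) E"
    and "\<And>n. \<kappa> n = (\<integral>t. t ^ n \<partial>scalar_measure E (basis_vec 0))"
  shows "\<forall>\<zeta> :: complex.
    (a \<le> sqrt 2 \<and> cmod \<zeta> < 1 \<or> a > sqrt 2 \<and> cmod \<zeta> < 2 / a\<^sup>2 * sqrt (a\<^sup>2 - 1)) \<longrightarrow>
    (\<lambda>n. complex_of_real (\<kappa> n) * \<zeta> ^ n) sums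
      (2 / (complex_of_real (a\<^sup>2) * csqrt (1 - \<zeta>\<^sup>2) + 2 - complex_of_real (a\<^sup>2)))"
proof (intro allI impI)
  fix \<zeta> :: complex
  assume \<zeta>: "a \<le> sqrt 2 \<and> cmod \<zeta> < 1 \<or> a > sqrt 2 \<and> cmod \<zeta> < 2 / a\<^sup>2 * sqrt (a\<^sup>2 - 1)"
  let ?H = "jacobi_op a"
  define \<rho> where "\<rho> = (if a \<le> sqrt 2 then 1 else 2 / a\<^sup>2 * sqrt (a\<^sup>2 - 1))"
  have \<zeta>\<rho>: "cmod \<zeta> < \<rho>" using \<zeta> by (auto simp: \<rho>_def)
  then have \<rho>0: "\<rho> > 0" by (meson norm_ge_zero le_less_trans)
  have \<rho>1: "\<rho> \<le> 1"
  proof (cases "a \<le> sqrt 2")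
    case False
    \<comment> \<open>The arithmetic-geometric mean inequality keeps the disc inside the unit disc,
      where the branch of the root is holomorphic.\<close>
    have "2 * sqrt (a\<^sup>2 - 1) * 1 \<le> (sqrt (a\<^sup>2 - 1))\<^sup>2 + 1\<^sup>2"
      by (rule sum_squares_bound)
    also have "\<dots> = a\<^sup>2"
      using False real_sqrt_lt_0_iff power_strict_mono[of "sqrt 2" a 2] by simp
    finally show ?thesis using False assms(1) by (simp add: \<rho>_def)
  qed (simp add: \<rho>_def)
  have nz: "complex_of_real (a\<^sup>2) * csqrt (1 - z\<^sup>2) + 2 - complex_of_real (a\<^sup>2) \<noteq> 0"
    if "cmod z < \<rho>" for z
    using that by (intro generating_function_denominator_nonzero assms(1)) (auto simp: \<rho>_def split: if_splits)
  have \<kappa>: "complex_of_real (\<kappa> n) = coord ((?H ^^ n) (basis_vec 0)) 0" for n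
    using cinner_funpow_self[OF jacobi_op_bounded jacobi_op_self_adjoint assms(2), of n "basis_vec 0"]
    by (simp add: assms(3) cinner_basis_vec)
  define F where "F = Abs_fps (\<lambda>n. complex_of_real (\<kappa> n))"
  \<comment> \<open>The value of \<open>onorm ?H\<close> stays unknown: its finiteness gives the
    identity near 0, which fixes the Taylor coefficients, and holomorphy carries convergence to
    radius \<open>\<rho>\<close>.\<close>
  have "gen_fun a has_fps_expansion F"
  proof (rule has_fps_expansionI)
    have "((\<lambda>z. onorm ?H * cmod z) \<longlongrightarrow> onorm ?H * cmod 0) (nhds 0)"
      by (intro tendsto_intros filterlim_ident)
    then have "\<forall>\<^sub>F z in nhds 0. onorm ?H * cmod z < 1"
      by (rule order_tendstoD) simp
    moreover have "\<forall>\<^sub>F z in nhds 0. z \<in> ball (0::complex) \<rho>"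
      using \<rho>0 by (intro eventually_nhds_in_open) auto
    ultimately show "\<forall>\<^sub>F z in nhds 0. (\<lambda>n. fps_nth F n * z ^ n) sums gen_fun a z"
    proof eventually_elim
      case (elim z)
      then show ?case
        using sums_gen_fun_near_0[of z a] nz[of z] \<rho>1 by (simp add: F_def \<kappa>)
    qed
  qed
  moreover have "gen_fun a holomorphic_on eball 0 \<rho>"
  proof -
    have "(\<lambda>z. csqrt (1 - z\<^sup>2)) holomorphic_on ball 0 \<rho>"
      by (rule holomorphic_on_subset[OF csqrt_branch(1)]) (use \<rho>1 in auto)
    then show ?thesis
      unfolding gen_fun_def using nz by (auto intro!: holomorphic_intros)
  qed
  ultimately have "(\<lambda>n. fps_nth F n * \<zeta> ^ n) sums gen_fun a \<zeta>"
    by (rule has_fps_expansion_imp_sums_complex) (use \<zeta>\<rho> in simp)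
  then show "(\<lambda>n. complex_of_real (\<kappa> n) * \<zeta> ^ n) sums
      (2 / (complex_of_real (a\<^sup>2) * csqrt (1 - \<zeta>\<^sup>2) + 2 - complex_of_real (a\<^sup>2)))"
    by (simp add: F_def gen_fun_def)
qed

end
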